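(* Let $\omega$ be an admissible weight and let $\varphi$ be an analytic self-map of $\mathbb{D}$ such that $C_{\varphi}$ is a bounded operator on $\mathcal{H}_{\omega}$. Then $C_{\varphi}$ has closed range if and only if there exists a constant $c>0$ such that for all $f\in\mathcal{H}_{\omega}$ $$\int_{\mathbb{D}}|f'(z)|^2\,\tau_{\varphi,\omega}(z)\,\omega(z)\,dA(z)\ \geq\ c\int_{\mathbb{D}}|f'(z)|^2\,\omega(z)\,dA(z),$$ where $\tau_{\varphi,\omega}(z)=\frac{N_{\varphi,\omega}(z)}{\omega(z)}$.
   Context: $\mathbb{D}$ is the open unit disk in $\mathbb{C}$, $H(\mathbb{D})$ is the space of analytic functions on $\mathbb{D}$, and $dA$ is the normalized area measure on $\mathbb{D}$. A weight is a positive integrable function $\omega\in C^2[0,1)$, extended radially to $\mathbb{D}$ by $\omega(z)=\omega(|z|)$. A weight $\omega$ is admissible if: (W1) $\omega$ is non-increasing on $[0,1)$; (W2) $\omega(r)(1-r)^{-(1+\delta)}$ is non-decreasing for some $\delta>0$; (W3) $\lim_{r\to1^-}\omega(r)=0$; (W4) either $\omega$ is convex and $\lim_{r\to1}\omega'(r)=0$, or $\omega$ is concave. $\mathcal{H}_{\omega}$ is the Hilbert space of all $f\in H(\mathbb{D})$ with $\int_{\mathbb{D}}|f'(z)|^2\omega(z)\,dA(z)<\infty$, with norm $\|f\|_{\mathcal{H}_\omega}^2=|f(0)|^2+\int_{\mathbb{D}}|f'(z)|^2\omega(z)\,dA(z)$. For an analytic map $\varphi:\mathbb{D}\to\mathbb{D}$,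 the composition operator is $C_\varphi f=f\circ\varphi$, and the generalized Nevanlinna counting function is $N_{\varphi,\omega}(z)=\sum_{a:\,\varphi(a)=z}\omega(a)$ for $z\in\mathbb{D}\setminus\{\varphi(0)\}$ (an empty sum is $0$). Convention: a bounded operator $T$ on a Hilbert space $H$ is said to have closed range when there is a constant $c>0$ such that $\|Tf\|_H\ge c\|f\|_H$ for every $f\in H$. (For non-constant $\varphi$, $C_\varphi$ is injective and this is equivalent to the range of $C_\varphi$ being a closed subspace.) *)

theory Defs
  imports "HOL-Complex_Analysis.Complex_Analysis"
begin

abbreviation unit_disk :: "complex set" where
  "unit_disk \<equiv> ball 0 1"

definition area_measure :: "complex measure" where
  "area_measure = scale_measure (ennreal (1 / pi)) (restrict_space lborel unit_disk)"

(* Derivatives are taken relative to the half-open interval, hence one-sided at 0. *)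
definition C2_on_unit :: "(real \<Rightarrow> real) \<Rightarrow> bool" where
  "C2_on_unit \<omega> \<longleftrightarrow> (\<exists>\<omega>1 \<omega>2.
     (\<forall>r\<in>{0..<1}. (\<omega> has_real_derivative \<omega>1 r) (at r within {0..<1})) \<and>
     (\<forall>r\<in>{0..<1}. (\<omega>1 has_real_derivative \<omega>2 r) (at r within {0..<1})) \<and>
     continuous_on {0..<1} \<omega>2)"

(* A weight is given by its radial profile; its value at a point z of the disk is \<omega> (cmod z).
   Values of the profile outside {0..<1} are irrelevant. *)
definition weight :: "(real \<Rightarrow> real) \<Rightarrow> bool" where
  "weight \<omega> \<longleftrightarrow> (\<forall>r\<in>{0..<1}. 0 < \<omega> r) \<and> set_integrable lborel {0..<1} \<omega> \<and> C2_on_unit \<omega>"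

definition admissible_weight :: "(real \<Rightarrow> real) \<Rightarrow> bool" where
  "admissible_weight \<omega> \<longleftrightarrow> weight \<omega> \<and>
     antimono_on {0..<1} \<omega> \<and>
     (\<exists>\<delta>>0. mono_on {0..<1} (\<lambda>r. \<omega> r * (1 - r) powr (- (1 + \<delta>)))) \<and>
     (\<omega> \<longlongrightarrow> 0) (at_left 1) \<and>
     (convex_on {0..<1} \<omega> \<and> (deriv \<omega> \<longlongrightarrow> 0) (at_left 1) \<or> concave_on {0..<1} \<omega>)"

definition dirichlet_integral :: "(real \<Rightarrow> real) \<Rightarrow> (complex \<Rightarrow> complex) \<Rightarrow> ennreal" where
  "dirichlet_integral \<omega> f =
     (\<integral>\<^sup>+z. ennreal ((cmod (deriv f z))\<^sup>2 * \<omega> (cmod z)) \<partial>area_measure)"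

(* Elements of the space are represented by total functions. Membership and norm depend only
   on the restriction to the disk. *)
definition H_space :: "(real \<Rightarrow> real) \<Rightarrow> (complex \<Rightarrow> complex) set" where
  "H_space \<omega> = {f. f holomorphic_on unit_disk \<and> dirichlet_integral \<omega> f < \<infinity>}"

definition H_norm :: "(real \<Rightarrow> real) \<Rightarrow> (complex \<Rightarrow> complex) \<Rightarrow> real" where
  "H_norm \<omega> f = sqrt ((cmod (f 0))\<^sup>2 + enn2real (dirichlet_integral \<omega> f))"

definition composition_operator ::
    "(complex \<Rightarrow> complex) \<Rightarrow> (complex \<Rightarrow> complex) \<Rightarrow> complex \<Rightarrow> complex" where
  "composition_operator \<phi> f = f \<circ> \<phi>"

(* Only applied to composition operators, for which linearity is automatic. *)
definition H_bounded ::
    "(real \<Rightarrow> real) \<Rightarrow> ((complex \<Rightarrow> complex) \<Rightarrow> complex \<Rightarrow> complex) \<Rightarrow> bool" where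
  "H_bounded \<omega> T \<longleftrightarrow> (\<forall>f\<in>H_space \<omega>. T f \<in> H_space \<omega>) \<and>
     (\<exists>C. \<forall>f\<in>H_space \<omega>. H_norm \<omega> (T f) \<le> C * H_norm \<omega> f)"

(* Closed range in the sense of being bounded below. For an injective bounded operator this is
   equivalent to the range being a closed subspace. *)
definition H_closed_range ::
    "(real \<Rightarrow> real) \<Rightarrow> ((complex \<Rightarrow> complex) \<Rightarrow> complex \<Rightarrow> complex) \<Rightarrow> bool" where
  "H_closed_range \<omega> T \<longleftrightarrow> (\<exists>c>0. \<forall>f\<in>H_space \<omega>. H_norm \<omega> (T f) \<ge> c * H_norm \<omega> f)"

(* The sum takes values in [0, \<infinity>], so it always exists. The counting function is usually
   defined for z \<noteq> \<phi> 0 only. That single point is a null set, and the formula is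
   used there as well. *)
definition nevanlinna_counting ::
    "(complex \<Rightarrow> complex) \<Rightarrow> (real \<Rightarrow> real) \<Rightarrow> complex \<Rightarrow> ennreal" where
  "nevanlinna_counting \<phi> \<omega> z = (\<Sum>\<^sub>\<infinity>a\<in>{a\<in>unit_disk. \<phi> a = z}. ennreal (\<omega> (cmod a)))"

definition tau ::
    "(complex \<Rightarrow> complex) \<Rightarrow> (real \<Rightarrow> real) \<Rightarrow> complex \<Rightarrow> ennreal" where
  "tau \<phi> \<omega> z = nevanlinna_counting \<phi> \<omega> z / ennreal (\<omega> (cmod z))"

end

theory Submission
  imports Defs
begin

text \<open>
  Write \<open>D f\<close> for the weighted Dirichlet integral, so that the squared norm of \<open>f\<close> is
  \<open>\<bar>f 0\<bar>\<^sup>2 + D f\<close>. Two facts carry the proof.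

  The first is the change of variables \<open>w = \<phi> z\<close> with multiplicity: since
  \<open>(f \<circ> \<phi>)' = (f' \<circ> \<phi>) \<phi>'\<close> and \<open>\<bar>\<phi>'\<bar>\<^sup>2\<close> is the Jacobian of \<open>\<phi>\<close>, the integral
  \<open>D (f \<circ> \<phi>)\<close> becomes the integral of \<open>\<bar>f'\<bar>\<^sup>2\<close> against the sum of \<open>\<omega>\<close> over the fibres of
  \<open>\<phi>\<close>, which is the counting function \<open>\<tau> \<omega>\<close> (\<open>area_formula_holomorphic\<close>,
  \<open>dirichlet_integral_compose\<close>). The set where \<open>\<phi>' \<noteq> 0\<close> splits into countably many Borel
  pieces on which \<open>\<phi>\<close> is injective; on each piece the usual substitution rule applies, and the
  critical values form a null set. Hence the inequality in the theorem says exactly that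
  \<open>D (f \<circ> \<phi>) \<ge> c D f\<close>.

  The second is that point evaluations are controlled by the Dirichlet integral:
  \<open>\<bar>f p - f 0\<bar>\<^sup>2 \<le> K D f\<close> for fixed \<open>p\<close> (\<open>point_evaluation_bound\<close>). It follows from the
  sub-mean value property of \<open>\<bar>f'\<bar>\<^sup>2\<close> on balls, because a positive non-increasing weight is
  bounded below on every smaller disk.

  It remains to compare a lower bound for the norm with a lower bound for \<open>D\<close>
  (\<open>closed_range_iff_dirichlet_lower_bound\<close>). Subtracting the constant \<open>f (\<phi> 0)\<close> from \<open>f\<close>
  leaves \<open>D f\<close> and \<open>D (f \<circ> \<phi>)\<close> unchanged and makes the composition vanish at the origin, so a
  norm bound gives a bound for \<open>D\<close>. Conversely \<open>\<bar>f 0\<bar>\<close> is at most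
  \<open>\<bar>f (\<phi> 0)\<bar> + \<bar>f (\<phi> 0) - f 0\<bar>\<close>, where the first term is part of the norm of \<open>f \<circ> \<phi>\<close> and
  the second is controlled by \<open>D f\<close>.
\<close>

section \<open>Substitution by injective holomorphic maps\<close>

text \<open>
  These two inverse linear isometries identify the plane with \<open>real^2\<close>, where the Jacobian of a
  map is the determinant of a matrix.
\<close>

definition vec_of_complex :: "complex \<Rightarrow> real^2" where
  "vec_of_complex z = vector [Re z, Im z]"

definition complex_of_vec :: "real^2 \<Rightarrow> complex" where
  "complex_of_vec v = Complex (v $ 1) (v $ 2)"

lemma vec_of_complex_inverse [simp]: "complex_of_vec (vec_of_complex z) = z"
  by (simp add: vec_of_complex_def complex_of_vec_def)

lemma complex_of_vec_inverse [simp]: "vec_of_complex (complex_of_vec v) = v"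
  by (simp add: vec_of_complex_def complex_of_vec_def vec_eq_iff forall_2)

lemma linear_complex_of_vec: "linear complex_of_vec"
  by (rule linearI) (auto simp: complex_of_vec_def complex_eq_iff)

lemma linear_vec_of_complex: "linear vec_of_complex"
  by (rule linearI) (auto simp: vec_of_complex_def vec_eq_iff forall_2)

lemma measurable_complex_of_vec [measurable]: "complex_of_vec \<in> borel \<rightarrow>\<^sub>M borel"
  using linear_complex_of_vec by (intro borel_measurable_continuous_onI linear_continuous_on)
    (simp add: linear_conv_bounded_linear)

lemma lborel_complex_eq_distr: "(lborel :: complex measure) = distr lborel borel complex_of_vec"
proof (rule lborel_eqI)
  fix l u :: complex
  assume le: "\<And>b. b \<in> Basis \<Longrightarrow> l \<bullet> b \<le> u \<bullet> b"
  have eq: "complex_of_vec -` box l u = box (vec_of_complex l) (vec_of_complex u)"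
    by (auto simp: complex_of_vec_def vec_of_complex_def box_def Basis_complex_def Basis_vec_def inner_axis
        forall_2 inner_complex_def)
  have le2: "\<forall>b\<in>Basis. vec_of_complex l \<bullet> b \<le> vec_of_complex u \<bullet> b"
    using le[of 1] le[of \<i>] by (auto simp: vec_of_complex_def Basis_vec_def inner_axis forall_2 Basis_complex_def)
  have B: "(Basis :: (real^2) set) = {axis 1 1, axis 2 1}"
    by (auto simp: Basis_vec_def UNIV_2)
  have ne: "axis 1 (1::real) \<noteq> (axis 2 1 :: real^2)"
    by (simp add: axis_eq_axis)
  show "emeasure (distr lborel borel complex_of_vec) (box l u) = (\<Prod>b\<in>Basis. (u - l) \<bullet> b)"
    using le2 ne
    by (simp add: emeasure_distr eq emeasure_lborel_box_eq)
       (simp add: B Basis_complex_def vec_of_complex_def inner_axis)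
qed simp

text \<open>
  The image of \<open>E\<close> is the preimage of \<open>E\<close> under the inverse map, which is continuous on the open
  set \<open>\<phi> ` U\<close>.
\<close>

lemma borel_holomorphic_image:
  assumes "open U" "\<phi> holomorphic_on U" "inj_on \<phi> U" "E \<in> sets borel" "E \<subseteq> U"
  shows "\<phi> ` E \<in> sets borel"
proof -
  obtain \<psi> where \<psi>: "\<psi> holomorphic_on (\<phi> ` U)" "\<And>z. z \<in> U \<Longrightarrow> \<psi> (\<phi> z) = z"
    using holomorphic_has_inverse[OF assms(2,1,3)] by metis
  have oV: "open (\<phi> ` U)" by (rule open_mapping_thm3) fact+
  have "continuous_on (\<phi> ` U) \<psi>" using \<psi> by (simp add: holomorphic_on_imp_continuous_on)
  then have "\<psi> \<in> borel_measurable (restrict_space borel (\<phi> ` U))"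
    by (rule borel_measurable_continuous_on_restrict)
  from measurable_sets[OF this assms(4)]
  have "\<psi> -` E \<inter> \<phi> ` U \<in> sets (restrict_space borel (\<phi> ` U))"
    by (simp add: space_restrict_space)
  then have "\<psi> -` E \<inter> \<phi> ` U \<in> sets borel"
    using oV by (subst (asm) sets_restrict_space_iff) auto
  also have "\<psi> -` E \<inter> \<phi> ` U = \<phi> ` E" using \<psi>(2) assms(5) by (force simp: subset_iff)
  finally show ?thesis .
qed

text \<open>
  By the Cauchy-Riemann equations the real derivative of \<open>\<phi>\<close> is multiplication by \<open>a + \<i> b\<close>,
  with matrix rows \<open>(a, -b)\<close> and \<open>(b, a)\<close>, so the Jacobian determinant is
  \<open>a\<^sup>2 + b\<^sup>2 = \<bar>\<phi>'\<bar>\<^sup>2\<close>. The area may be infinite.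
\<close>

lemma emeasure_holomorphic_image:
  assumes "open U" "\<phi> holomorphic_on U" "inj_on \<phi> U"
    and E: "E \<in> sets borel" "E \<subseteq> U"
  shows "emeasure lborel (\<phi> ` E) = (\<integral>\<^sup>+z\<in>E. ennreal ((cmod (deriv \<phi> z))\<^sup>2) \<partial>lborel)"
proof -
  have im: "\<phi> ` E \<in> sets borel" using assms by (rule borel_holomorphic_image)
  define S where "S = complex_of_vec -` E"
  define g where "g = vec_of_complex \<circ> \<phi> \<circ> complex_of_vec"
  define g' where "g' x = vec_of_complex \<circ> (\<lambda>h. deriv \<phi> (complex_of_vec x) * h) \<circ> complex_of_vec" for x
  define J where "J x = (cmod (deriv \<phi> (complex_of_vec x)))\<^sup>2" for x
  have S[measurable]: "S \<in> sets borel"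
    unfolding S_def using measurable_sets[OF measurable_complex_of_vec E(1)] by simp
  have det: "\<bar>det (matrix (g' x))\<bar> = J x" for x
    by (simp add: det_2 matrix_def g'_def vec_of_complex_def complex_of_vec_def axis_def J_def cmod_power2)
      (simp add: power2_eq_square)
  have der: "(g has_derivative g' x) (at x within S)" if "x \<in> S" for x
  proof -
    have x: "complex_of_vec x \<in> U" using that E by (auto simp: S_def)
    have 1: "(\<phi> has_derivative (\<lambda>h. deriv \<phi> (complex_of_vec x) * h)) (at (complex_of_vec x))"
      using holomorphic_derivI[OF assms(2,1) x] by (simp add: has_field_derivative_def)
    have 2: "(\<phi> \<circ> complex_of_vec has_derivative (\<lambda>h. deriv \<phi> (complex_of_vec x) * h) \<circ> complex_of_vec) (at x)"
      by (rule diff_chain_at[OF linear_imp_has_derivative[OF linear_complex_of_vec] 1])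
    show ?thesis
      unfolding g_def g'_def comp_assoc
      by (rule has_derivative_at_withinI, rule diff_chain_at[OF 2 linear_imp_has_derivative[OF linear_vec_of_complex]])
  qed
  have inj: "inj_on g S"
  proof (rule inj_onI)
    fix x y assume xy: "x \<in> S" "y \<in> S" "g x = g y"
    then have "complex_of_vec (g x) = complex_of_vec (g y)" by simp
    then have "\<phi> (complex_of_vec x) = \<phi> (complex_of_vec y)"
      unfolding g_def comp_apply vec_of_complex_inverse .
    then have "complex_of_vec x = complex_of_vec y"
      using xy E(2) assms(3) by (auto simp: S_def dest: inj_onD)
    then have "vec_of_complex (complex_of_vec x) = vec_of_complex (complex_of_vec y)" by simp
    then show "x = y" by simp
  qed
  have im_eq: "g ` S = complex_of_vec -` (\<phi> ` E)"
  proof (intro equalityI subsetI)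
    fix x assume "x \<in> complex_of_vec -` (\<phi> ` E)"
    then obtain z where z: "z \<in> E" "complex_of_vec x = \<phi> z" by auto
    then have "vec_of_complex z \<in> S" "g (vec_of_complex z) = x"
      by (auto simp: S_def g_def simp flip: z(2))
    then show "x \<in> g ` S" by blast
  qed (auto simp: g_def S_def)
  have gS [measurable]: "g ` S \<in> sets borel"
    unfolding im_eq using measurable_sets[OF measurable_complex_of_vec im] by simp
  note mi = has_measure_differentiable_image[of S g g', OF _ der inj, unfolded det]
  have S': "S \<in> sets lebesgue" by simp
  have m1: "emeasure lborel (\<phi> ` E) = emeasure lborel (g ` S)"
    by (subst lborel_complex_eq_distr) (simp add: emeasure_distr im im_eq)
  have phi': "(\<lambda>z. indicator E z * (cmod (deriv \<phi> z))\<^sup>2) \<in> borel_measurable borel"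
  proof -
    have "continuous_on U (deriv \<phi>)"
      using assms by (simp add: holomorphic_deriv holomorphic_on_imp_continuous_on)
    then have "(\<lambda>z. indicator U z *\<^sub>R deriv \<phi> z) \<in> borel_measurable borel"
      using borel_measurable_continuous_on_indicator[of U "deriv \<phi>"] \<open>open U\<close> by simp
    then have "(\<lambda>z. indicator E z * (cmod (indicator U z *\<^sub>R deriv \<phi> z))\<^sup>2) \<in> borel_measurable borel"
      using E(1) by measurable
    also have "(\<lambda>z. indicator E z * (cmod (indicator U z *\<^sub>R deriv \<phi> z))\<^sup>2) = (\<lambda>z. indicator E z * (cmod (deriv \<phi> z))\<^sup>2)"
      using E(2) by (auto simp: indicator_def fun_eq_iff)
    finally show ?thesis .
  qed
  have m2: "(\<integral>\<^sup>+z\<in>E. ennreal ((cmod (deriv \<phi> z))\<^sup>2) \<partial>lborel) = (\<integral>\<^sup>+x. ennreal (indicator S x * J x) \<partial>lborel)"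
  proof -
    have "(\<integral>\<^sup>+z\<in>E. ennreal ((cmod (deriv \<phi> z))\<^sup>2) \<partial>lborel) = (\<integral>\<^sup>+z. ennreal (indicator E z * (cmod (deriv \<phi> z))\<^sup>2) \<partial>lborel)"
      by (intro nn_integral_cong) (auto simp: indicator_def)
    also have "\<dots> = (\<integral>\<^sup>+x. ennreal (indicator S x * J x) \<partial>lborel)"
      by (subst lborel_complex_eq_distr, subst nn_integral_distr)
        (use phi' in \<open>auto simp: S_def J_def indicator_def intro!: nn_integral_cong\<close>)
    finally show ?thesis .
  qed
  have Jm: "(\<lambda>x. indicator S x * J x) \<in> borel_measurable borel"
    using measurable_compose[OF measurable_complex_of_vec phi'] unfolding S_def J_def indicator_def by simp
  have J0: "0 \<le> indicator S x * J x" for x by (auto simp: J_def)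
  have hi: "(J has_integral m) S \<longleftrightarrow> ((\<lambda>x. indicator S x * J x) has_integral m) UNIV" for m
    by (subst has_integral_restrict_UNIV[symmetric], intro has_integral_cong) (auto simp: indicator_def)
  show ?thesis
  proof (cases "(\<integral>\<^sup>+x. ennreal (indicator S x * J x) \<partial>lborel) = \<infinity>")
    case False
    then obtain m where m: "(\<integral>\<^sup>+x. ennreal (indicator S x * J x) \<partial>lborel) = ennreal m" "m \<ge> 0"
      by (metis ennreal_cases infinity_ennreal_def)
    from nn_integral_has_integral[OF Jm J0 m] have "g ` S \<in> lmeasurable \<and> measure lebesgue (g ` S) = m"
      using mi[OF S'] by (simp add: hi)
    then have "emeasure lebesgue (g ` S) = ennreal m"
      by (metis emeasure_eq_measure2)
    then show ?thesis using m1 m2 m gS by simp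
  next
    case True
    have "emeasure lborel (g ` S) = \<infinity>"
    proof (rule ccontr)
      assume "emeasure lborel (g ` S) \<noteq> \<infinity>"
      then have "g ` S \<in> lmeasurable"
        using gS by (intro fmeasurableI) (auto simp: less_top)
      then have "((\<lambda>x. indicator S x * J x) has_integral measure lebesgue (g ` S)) UNIV"
        using mi[OF S', of "measure lebesgue (g ` S)"] unfolding hi by (simp only: simp_thms)
      from nn_integral_has_integral_lborel[OF Jm J0 this] True show False by simp
    qed
    then show ?thesis using m1 m2 True by simp
  qed
qed

text \<open>
  Applied to the Borel subsets of \<open>E\<close>, the preceding lemma says that \<open>\<phi>\<close> pushes the measure with
  density \<open>\<bar>\<phi>'\<bar>\<^sup>2\<close> on \<open>E\<close> forward to Lebesgue measure on \<open>\<phi> ` E\<close>. The substitution rule is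
  the equality of the integrals of \<open>H\<close> against these two measures.
\<close>

lemma nn_integral_holomorphic_image:
  fixes H :: "complex \<Rightarrow> ennreal"
  assumes U: "open U" "\<phi> holomorphic_on U" "inj_on \<phi> U"
    and E: "E \<in> sets borel" "E \<subseteq> U" and H[measurable]: "H \<in> borel_measurable borel"
  shows "(\<integral>\<^sup>+z\<in>E. H (\<phi> z) * ennreal ((cmod (deriv \<phi> z))\<^sup>2) \<partial>lborel) = (\<integral>\<^sup>+w\<in>\<phi> ` E. H w \<partial>lborel)"
proof -
  define f where "f z = indicator U z *\<^sub>R \<phi> z" for z
  define d where "d z = ennreal ((cmod (indicator U z *\<^sub>R deriv \<phi> z))\<^sup>2) * indicator E z" for z
  have "continuous_on U \<phi>" "continuous_on U (deriv \<phi>)"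
    using U by (simp_all add: holomorphic_deriv holomorphic_on_imp_continuous_on)
  then have [measurable]: "f \<in> borel_measurable borel" "(\<lambda>z. indicator U z *\<^sub>R deriv \<phi> z) \<in> borel_measurable borel"
    using borel_measurable_continuous_on_indicator[of U "deriv \<phi>"] 
      borel_measurable_continuous_on_indicator[of U "\<phi>"] \<open>open U\<close> 
    by (simp_all add: f_def[abs_def])
  have [measurable]: "d \<in> borel_measurable borel"
    unfolding d_def using E(1) by measurable
  have im[measurable]: "\<phi> ` E \<in> sets borel" using borel_holomorphic_image[OF U E] .
  have d: "d z = ennreal ((cmod (deriv \<phi> z))\<^sup>2) * indicator E z" for z
    using E(2) by (auto simp: d_def indicator_def)
  have "distr (density lborel d) borel f = density lborel (indicator (\<phi> ` E))"
  proof (rule measure_eqI)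
    fix A assume "A \<in> sets (distr (density lborel d) borel f)"
    then have A[measurable]: "A \<in> sets borel" by simp
    have B: "f -` A \<inter> E \<in> sets borel"
      using measurable_sets[of f borel borel A] E(1) by auto
    have "emeasure (distr (density lborel d) borel f) A = (\<integral>\<^sup>+z. d z * indicator (f -` A) z \<partial>lborel)"
      using measurable_sets[of f borel borel A] by (simp add: emeasure_distr emeasure_density)
    also have "\<dots> = (\<integral>\<^sup>+z\<in>f -` A \<inter> E. ennreal ((cmod (deriv \<phi> z))\<^sup>2) \<partial>lborel)"
      by (intro nn_integral_cong) (auto simp: d indicator_def)
    also have "\<dots> = emeasure lborel (\<phi> ` (f -` A \<inter> E))"
      using E(2) by (intro emeasure_holomorphic_image[OF U B, symmetric]) auto
    also have "\<phi> ` (f -` A \<inter> E) = \<phi> ` E \<inter> A" using E(2) by (force simp: f_def)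
    also have "emeasure lborel (\<phi> ` E \<inter> A) = emeasure (density lborel (indicator (\<phi> ` E))) A"
      by (simp add: emeasure_density indicator_inter_arith[symmetric])
    finally show "emeasure (distr (density lborel d) borel f) A = emeasure (density lborel (indicator (\<phi> ` E))) A" .
  qed simp
  then have "integral\<^sup>N (distr (density lborel d) borel f) H = integral\<^sup>N (density lborel (indicator (\<phi> ` E))) H"
    by simp
  then have "(\<integral>\<^sup>+z. d z * H (f z) \<partial>lborel) = (\<integral>\<^sup>+w. indicator (\<phi> ` E) w * H w \<partial>lborel)"
    by (simp add: nn_integral_distr nn_integral_density)
  moreover have "(\<integral>\<^sup>+z. d z * H (f z) \<partial>lborel) = (\<integral>\<^sup>+z\<in>E. H (\<phi> z) * ennreal ((cmod (deriv \<phi> z))\<^sup>2) \<partial>lborel)"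
    using E(2) by (intro nn_integral_cong) (auto simp: d f_def indicator_def mult_ac)
  ultimately show ?thesis by (simp add: mult_ac)
qed

section \<open>The area formula with multiplicity\<close>

lemma open_imp_fsigma:
  fixes U :: "'a::euclidean_space set"
  assumes "open U"
  shows "fsigma U"
proof -
  obtain D where D: "countable D" "\<And>X. X \<in> D \<Longrightarrow> \<exists>a b. X = cbox a b" "\<Union>D = U"
    using open_countable_Union_open_cbox[OF assms] by (metis (no_types))
  have ne: "insert {} D \<noteq> {}" by simp
  have "range (from_nat_into (insert {} D)) = insert {} D"
    using D(1) by (intro range_from_nat_into) auto
  moreover have "closed (from_nat_into (insert {} D) n)" for n
    using from_nat_into[OF ne, of n] D(2)[of "from_nat_into (insert {} D) n"] by (auto simp: closed_cbox)
  ultimately show ?thesis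
    using fsigma.intros[of "from_nat_into (insert {} D)"] D(3) by simp
qed

text \<open>
  The zeros of \<open>deriv \<phi>\<close> are countable unless this function is constant. If it is constantly
  zero, there are uncountably many critical points, but \<open>\<phi>\<close> takes only one value. Constant maps
  are thereby covered by everything below.
\<close>

lemma countable_critical_values:
  assumes U: "open U" "connected U" and \<phi>: "\<phi> holomorphic_on U"
  shows "countable (\<phi> ` {z\<in>U. deriv \<phi> z = 0})"
proof (cases "deriv \<phi> constant_on U")
  case False
  then have "countable {z\<in>U. deriv \<phi> z = 0}"
    using U \<phi> by (intro holomorphic_countable_zeros) (auto simp: holomorphic_deriv open_imp_fsigma)
  then show ?thesis by (rule countable_image)
next
  case True
  then obtain c where c: "\<And>z. z \<in> U \<Longrightarrow> deriv \<phi> z = c" by (auto simp: constant_on_def)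
  show ?thesis
  proof (cases "c = 0")
    case True
    then have "(\<phi> has_field_derivative 0) (at z)" if "z \<in> U" for z
      using holomorphic_derivI[OF \<phi> U(1) that] c[OF that] by simp
    then obtain a where "\<And>z. z \<in> U \<Longrightarrow> \<phi> z = a"
      using DERIV_zero_connected_constant[OF U(2,1), of "{}" \<phi>] \<phi>
      by (auto simp: holomorphic_on_imp_continuous_on)
    then have "\<phi> ` {z\<in>U. deriv \<phi> z = 0} \<subseteq> {a}" by auto
    then show ?thesis by (rule countable_subset) simp
  next
    case False
    then have "{z\<in>U. deriv \<phi> z = 0} = {}" using c by auto
    then show ?thesis by (simp only: image_empty countable_empty)
  qed
qed

text \<open>
  This turns the unordered sum over a fibre of \<open>\<phi>\<close> into a series indexed by the pieces of a
  partition, each of which meets the fibre in at most one point. A series of measurable functions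
  is measurable, and integration commutes with it.
\<close>

lemma infsum_disjoint_subsingletons:
  fixes f :: "'a \<Rightarrow> ennreal"
  assumes disj: "disjoint_family A" and single: "\<And>n. A n \<noteq> {} \<Longrightarrow> A n = {p n}"
  shows "(\<Sum>\<^sub>\<infinity>a\<in>(\<Union>n. A n). f a) = (\<Sum>n::nat. if A n = {} then 0 else f (p n))"
proof -
  define N where "N = {n. A n \<noteq> {}}"
  have "inj_on p N"
  proof (rule inj_onI)
    fix m n assume "m \<in> N" "n \<in> N" "p m = p n"
    then have "p m \<in> A m \<inter> A n" using single[of m] single[of n] by (auto simp: N_def)
    then show "m = n" using disj by (auto simp: disjoint_family_on_def)
  qed
  moreover have "p ` N = (\<Union>n. A n)"
    using single unfolding N_def by blast
  ultimately have "(\<Sum>\<^sub>\<infinity>a\<in>(\<Union>n. A n). f a) = (\<Sum>\<^sub>\<infinity>n\<in>N. f (p n))"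
    using infsum_reindex_bij_betw[of p N "\<Union>n. A n" f] by (simp add: bij_betw_def)
  also have "\<dots> = (\<Sum>\<^sub>\<infinity>n. if A n = {} then 0 else f (p n))"
    by (intro infsum_cong_neutral) (auto simp: N_def)
  also have "\<dots> = (\<Sum>n. if A n = {} then 0 else f (p n))"
    by (intro sums_unique has_sum_imp_sums has_sum_infsum nonneg_summable_on_complete) auto
  finally show ?thesis .
qed

text \<open>
  Every point with non-zero derivative has a neighbourhood on which \<open>\<phi>\<close> is injective. Countably
  many of these suffice, and removing from each one its predecessors makes them disjoint. The open
  sets \<open>B n\<close> are kept because the inverse function theorem needs an open domain.
\<close>

lemma holomorphic_injective_partition:
  assumes U: "open U" and \<phi>: "\<phi> holomorphic_on U"
  obtains B E :: "nat \<Rightarrow> complex set"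
  where "\<And>n. open (B n)" "\<And>n. B n \<subseteq> U" "\<And>n. inj_on \<phi> (B n)"
    and "\<And>n. E n \<in> sets borel" "\<And>n. E n \<subseteq> B n" "disjoint_family E"
    and "(\<Union>n. E n) = {z\<in>U. deriv \<phi> z \<noteq> 0}"
proof -
  let ?G = "{z\<in>U. deriv \<phi> z \<noteq> 0}"
  define F where "F = {B. open B \<and> B \<subseteq> ?G \<and> inj_on \<phi> B}"
  have "open (U \<inter> deriv \<phi> -` (- {0}))"
    using U \<phi> by (intro continuous_open_preimage) (auto simp: holomorphic_deriv holomorphic_on_imp_continuous_on)
  also have "U \<inter> deriv \<phi> -` (- {0}) = ?G" by auto
  finally have oG: "open ?G" .
  have "\<exists>B\<in>F. z \<in> B" if z: "z \<in> ?G" for z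
  proof -
    have "\<phi> holomorphic_on ?G" using \<phi> by (rule holomorphic_on_subset) auto
    then obtain r where "r > 0" "ball z r \<subseteq> ?G" "inj_on \<phi> (ball z r)"
      using has_complex_derivative_locally_injective[of \<phi> ?G z] z oG by auto
    then show ?thesis by (intro bexI[of _ "ball z r"]) (auto simp: F_def)
  qed
  then have UF: "\<Union>F = ?G" by (auto simp: F_def)
  obtain F' where F': "F' \<subseteq> F" "countable F'" "\<Union>F' = \<Union>F"
    using Lindelof[of F] by (auto simp: F_def)
  \<comment> \<open>With the empty set added, the cover can be enumerated even if there is no regular point.\<close>
  define B where "B = from_nat_into (insert {} F')"
  have rB: "range B = insert {} F'"
    unfolding B_def using F'(2) by (intro range_from_nat_into) auto
  have "{} \<in> F" by (simp add: F_def)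
  with rB F'(1) have "range B \<subseteq> F" by simp
  then have "B n \<in> F" for n by (rule subsetD) (rule rangeI)
  then have B: "open (B n)" "B n \<subseteq> ?G" "inj_on \<phi> (B n)" for n by (auto simp: F_def)
  have "(\<Union>n. disjointed B n) = ?G"
    using rB F'(3) UF by (simp add: UN_disjointed_eq)
  moreover have "disjointed B n \<in> sets borel" for n
  proof -
    have "range B \<subseteq> sets borel" using B(1) by auto
    from sets.range_disjointed_sets[OF this] show ?thesis by (rule subsetD) (rule rangeI)
  qed
  moreover have "B n \<subseteq> U" for n using B(2)[of n] by auto
  ultimately show thesis
    using B(1,3) disjointed_subset[of B] disjoint_family_disjointed[of B]
    by (intro that[of B "disjointed B"])
qed

text \<open>
  The measurable function \<open>M\<close> stands in for the fibre sum, whose measurability is only clear off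
  the critical values.
\<close>

lemma area_formula_holomorphic:
  fixes W :: "complex \<Rightarrow> ennreal"
  assumes U: "open U" "connected U" and \<phi>: "\<phi> holomorphic_on U" and W[measurable]: "W \<in> borel_measurable borel"
  obtains M :: "complex \<Rightarrow> ennreal" where "M \<in> borel_measurable borel"
    and "AE w in lborel. (\<Sum>\<^sub>\<infinity>a\<in>{a\<in>U. \<phi> a = w}. W a) = M w"
    and "\<And>H. H \<in> borel_measurable borel \<Longrightarrow>
      (\<integral>\<^sup>+z\<in>U. H (\<phi> z) * W z * ennreal ((cmod (deriv \<phi> z))\<^sup>2) \<partial>lborel) = (\<integral>\<^sup>+w. H w * M w \<partial>lborel)"
proof -
  obtain B E :: "nat \<Rightarrow> complex set"
    where B: "\<And>n. open (B n)" "\<And>n. B n \<subseteq> U" "\<And>n. inj_on \<phi> (B n)"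
    and E[measurable]: "\<And>n. E n \<in> sets borel" and EB: "\<And>n. E n \<subseteq> B n" and disj: "disjoint_family E"
    and UE: "(\<Union>n. E n) = {z\<in>U. deriv \<phi> z \<noteq> 0}"
    by (rule holomorphic_injective_partition[OF U(1) \<phi>]) (rule that)
  have hB: "\<phi> holomorphic_on B n" for n using \<phi> B(2) by (rule holomorphic_on_subset)
  have "\<exists>\<psi>. \<psi> holomorphic_on (\<phi> ` B n) \<and> (\<forall>z\<in>B n. \<psi> (\<phi> z) = z)" for n
    using holomorphic_has_inverse[OF hB B(1) B(3)] by metis
  then obtain \<psi> where \<psi>: "\<And>n. \<psi> n holomorphic_on (\<phi> ` B n)" "\<And>n z. z \<in> B n \<Longrightarrow> \<psi> n (\<phi> z) = z"
    by metis
  \<comment> \<open>The local inverse, extended by zero to a Borel function on the whole plane.\<close>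
  define p where "p n w = indicator (\<phi> ` B n) w *\<^sub>R \<psi> n w" for n w
  have oB: "open (\<phi> ` B n)" for n by (rule open_mapping_thm3[OF hB B(1) B(3)])
  have p_meas[measurable]: "p n \<in> borel_measurable borel" for n
    unfolding p_def using oB[of n] \<psi>(1)[of n]
    by (intro borel_measurable_continuous_on_indicator) (auto simp: holomorphic_on_imp_continuous_on)
  have p: "p n (\<phi> z) = z" if "z \<in> B n" for n z
    using that \<psi>(2) by (auto simp: p_def indicator_def)
  have imE[measurable]: "\<phi> ` E n \<in> sets borel" for n
    by (rule borel_holomorphic_image[OF B(1) hB B(3) E EB])
  define M where "M w = (\<Sum>n. W (p n w) * indicator (\<phi> ` E n) w)" for w
  have Mm: "M \<in> borel_measurable borel" unfolding M_def by measurable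
  moreover have "AE w in lborel. (\<Sum>\<^sub>\<infinity>a\<in>{a\<in>U. \<phi> a = w}. W a) = M w"
  proof (rule AE_I')
    show "\<phi> ` {z\<in>U. deriv \<phi> z = 0} \<in> null_sets lborel"
      by (intro countable_imp_null_set_lborel countable_critical_values U \<phi>)
    have "(\<Sum>\<^sub>\<infinity>a\<in>{a\<in>U. \<phi> a = w}. W a) = M w" if w: "w \<notin> \<phi> ` {z\<in>U. deriv \<phi> z = 0}" for w
    proof -
      let ?A = "\<lambda>n. {a\<in>E n. \<phi> a = w}"
      have "{a\<in>U. \<phi> a = w} = {a\<in>(\<Union>n. E n). \<phi> a = w}" using w unfolding UE by auto
      also have "\<dots> = (\<Union>n. ?A n)" by auto
      finally have "(\<Sum>\<^sub>\<infinity>a\<in>{a\<in>U. \<phi> a = w}. W a) = (\<Sum>\<^sub>\<infinity>a\<in>(\<Union>n. ?A n). W a)" by simp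
      also have "\<dots> = (\<Sum>n. if ?A n = {} then 0 else W (p n w))"
      proof (rule infsum_disjoint_subsingletons)
        show "disjoint_family ?A" using disj unfolding disjoint_family_on_def by blast
        show "?A n = {p n w}" if "?A n \<noteq> {}" for n
        proof -
          have "p n w = a" if "a \<in> ?A n" for a using that p[of a n] EB[of n] by auto
          with that show ?thesis by auto
        qed
      qed
      also have "\<dots> = M w"
        unfolding M_def by (intro suminf_cong) (auto simp: indicator_def)
      finally show ?thesis .
    qed
    then show "{w \<in> space lborel. (\<Sum>\<^sub>\<infinity>a\<in>{a\<in>U. \<phi> a = w}. W a) \<noteq> M w} \<subseteq> \<phi> ` {z\<in>U. deriv \<phi> z = 0}"
      by blast
  qed
  moreover have "(\<integral>\<^sup>+z\<in>U. H (\<phi> z) * W z * ennreal ((cmod (deriv \<phi> z))\<^sup>2) \<partial>lborel) = (\<integral>\<^sup>+w. H w * M w \<partial>lborel)"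
    if H[measurable]: "H \<in> borel_measurable borel" for H :: "complex \<Rightarrow> ennreal"
  proof -
    define f where "f z = H (indicator U z *\<^sub>R \<phi> z) * W z * ennreal ((cmod (indicator U z *\<^sub>R deriv \<phi> z))\<^sup>2)" for z
    have "continuous_on U \<phi>" "continuous_on U (deriv \<phi>)"
      using U \<phi> by (simp_all add: holomorphic_deriv holomorphic_on_imp_continuous_on)
    then have [measurable]: "(\<lambda>z. indicator U z *\<^sub>R \<phi> z) \<in> borel_measurable borel" "(\<lambda>z. indicator U z *\<^sub>R deriv \<phi> z) \<in> borel_measurable borel"
      using borel_measurable_continuous_on_indicator[of U "deriv \<phi>"]
        borel_measurable_continuous_on_indicator[of U "\<phi>"] \<open>open U\<close> by simp_all
    have fm[measurable]: "f \<in> borel_measurable borel" unfolding f_def by measurable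
    have piece: "(\<integral>\<^sup>+z\<in>E n. f z \<partial>lborel) = (\<integral>\<^sup>+w. H w * (W (p n w) * indicator (\<phi> ` E n) w) \<partial>lborel)" for n
    proof -
      have "(\<integral>\<^sup>+z\<in>E n. f z \<partial>lborel) = (\<integral>\<^sup>+z\<in>E n. (\<lambda>w. H w * W (p n w)) (\<phi> z) * ennreal ((cmod (deriv \<phi> z))\<^sup>2) \<partial>lborel)"
        using EB[of n] B(2)[of n] p by (intro nn_integral_cong) (auto simp: f_def indicator_def)
      also have "\<dots> = (\<integral>\<^sup>+w\<in>\<phi> ` E n. H w * W (p n w) \<partial>lborel)"
        by (intro nn_integral_holomorphic_image[OF B(1) hB B(3) E EB]) measurable
      finally show ?thesis by (simp add: mult_ac)
    qed
    have "(\<integral>\<^sup>+z\<in>U. H (\<phi> z) * W z * ennreal ((cmod (deriv \<phi> z))\<^sup>2) \<partial>lborel) = (\<integral>\<^sup>+z\<in>(\<Union>n. E n). f z \<partial>lborel)"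
      unfolding UE by (intro nn_integral_cong) (auto simp: f_def indicator_def)
    also have "\<dots> = (\<Sum>n. \<integral>\<^sup>+z\<in>E n. f z \<partial>lborel)"
      using disj by (intro nn_integral_disjoint_family) auto
    also have "\<dots> = (\<integral>\<^sup>+w. (\<Sum>n. H w * (W (p n w) * indicator (\<phi> ` E n) w)) \<partial>lborel)"
      unfolding piece by (intro nn_integral_suminf[symmetric]) measurable
    also have "\<dots> = (\<integral>\<^sup>+w. H w * M w \<partial>lborel)" by (simp add: M_def)
    finally show ?thesis .
  qed
  ultimately show thesis by (rule that)
qed

section \<open>The sub-mean value property on balls\<close>

text \<open>
  Cauchy's formula for \<open>h\<^sup>2\<close> expresses \<open>h 0 ^ 2\<close> as the mean of \<open>h\<^sup>2\<close> over the unit circle, and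
  passing to absolute values gives the inequality.
\<close>

lemma circle_mean_value_square:
  assumes h: "h holomorphic_on cball 0 1"
  shows "ennreal ((cmod (h 0))\<^sup>2) \<le> (\<integral>\<^sup>+t\<in>{0..1::real}. ennreal ((cmod (h (exp (2 * of_real pi * \<i> * of_real t))))\<^sup>2) \<partial>lborel)"
proof -
  define e where "e t = exp (2 * of_real pi * \<i> * of_real t)" for t :: real
  have e: "cmod (e t) = 1" "e t \<noteq> 0" for t by (auto simp: e_def)
  have "((\<lambda>u. (h u)\<^sup>2 / (u - 0)) has_contour_integral (2 * of_real pi * \<i> * (h 0)\<^sup>2)) (circlepath 0 1)"
    using h by (intro Cauchy_integral_circlepath_simple holomorphic_intros) auto
  then have "((\<lambda>t. (h (e t))\<^sup>2 / e t * vector_derivative (circlepath 0 1) (at t within {0..1}))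
      has_integral 2 * of_real pi * \<i> * (h 0)\<^sup>2) {0..1}"
    unfolding has_contour_integral_def by (simp add: circlepath e_def)
  also have "?this \<longleftrightarrow> ((\<lambda>t. (2 * of_real pi * \<i>) * (h (e t))\<^sup>2) has_integral 2 * of_real pi * \<i> * (h 0)\<^sup>2) {0..1}"
    by (intro has_integral_cong) (auto simp: vector_derivative_circlepath01 e_def)
  finally have "((\<lambda>t. inverse (2 * of_real pi * \<i>) * ((2 * of_real pi * \<i>) * (h (e t))\<^sup>2))
      has_integral inverse (2 * of_real pi * \<i>) * (2 * of_real pi * \<i> * (h 0)\<^sup>2)) {0..1}"
    by (rule has_integral_mult_right)
  then have I: "((\<lambda>t. (h (e t))\<^sup>2) has_integral (h 0)\<^sup>2) {0..1}"
    by (simp add: field_simps)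
  have "continuous_on {0..1} (\<lambda>t. h (e t))"
    using e by (intro continuous_on_compose2[OF holomorphic_on_imp_continuous_on[OF h]])
      (auto simp: e_def intro!: continuous_intros)
  then have int: "(\<lambda>t. (cmod (h (e t)))\<^sup>2) integrable_on {0..1}"
    by (intro integrable_continuous_interval continuous_intros)
  have "(cmod (h 0))\<^sup>2 = norm (integral {0..1} (\<lambda>t. (h (e t))\<^sup>2))"
    using I by (simp add: integral_unique norm_power)
  also have "\<dots> \<le> integral {0..1} (\<lambda>t. (cmod (h (e t)))\<^sup>2)"
    using I int by (intro integral_norm_bound_integral) (auto simp: has_integral_integrable norm_power)
  finally have "ennreal ((cmod (h 0))\<^sup>2) \<le> ennreal (integral {0..1} (\<lambda>t. (cmod (h (e t)))\<^sup>2))"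
    by (rule ennreal_leI)
  also have "\<dots> = (\<integral>\<^sup>+t\<in>{0..1}. ennreal ((cmod (h (e t)))\<^sup>2) \<partial>lborel)"
    using nn_integral_has_integral_lebesgue'[OF _ integrable_integral[OF int]] by simp
  finally show ?thesis by (simp add: e_def)
qed

lemma nn_integral_ball_rotate:
  fixes F :: "complex \<Rightarrow> ennreal"
  assumes F: "F \<in> borel_measurable borel" and c: "cmod c = 1"
  shows "(\<integral>\<^sup>+w\<in>ball z r. F (z + c * (w - z)) \<partial>lborel) = (\<integral>\<^sup>+w\<in>ball z r. F w \<partial>lborel)"
proof -
  define \<phi> where "\<phi> w = z + c * (w - z)" for w
  have c0: "c \<noteq> 0" using c by auto
  have im: "\<phi> ` ball z r = ball z r"
  proof (intro equalityI subsetI)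
    fix w assume w: "w \<in> ball z r"
    have "\<phi> (z + (w - z) / c) = w" using c0 by (simp add: \<phi>_def)
    moreover have "z + (w - z) / c \<in> ball z r"
      using w c by (simp add: dist_norm norm_divide norm_minus_commute)
    ultimately show "w \<in> \<phi> ` ball z r" by (metis imageI)
  qed (use c in \<open>auto simp: \<phi>_def dist_norm norm_mult norm_minus_commute\<close>)
  have "(\<phi> has_field_derivative c) (at w)" for w
    unfolding \<phi>_def by (auto intro!: derivative_eq_intros)
  then have "deriv \<phi> w = c" for w by (rule DERIV_imp_deriv)
  moreover have "(\<integral>\<^sup>+w\<in>ball z r. F (\<phi> w) * ennreal ((cmod (deriv \<phi> w))\<^sup>2) \<partial>lborel) = (\<integral>\<^sup>+w\<in>\<phi> ` ball z r. F w \<partial>lborel)"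
    using c0 F by (intro nn_integral_holomorphic_image[of UNIV])
      (auto simp: inj_on_def \<phi>_def intro!: holomorphic_intros)
  ultimately show ?thesis using c by (simp add: im) (simp add: \<phi>_def)
qed

text \<open>
  The integral over the ball equals its average over all rotations about the centre. After
  exchanging the two integrations, the inner one runs over a circle through \<open>w\<close> and is at least
  \<open>\<bar>g z\<bar>\<^sup>2\<close>. This replaces integration in polar coordinates.
\<close>

lemma holomorphic_sub_mean_value_ball:
  assumes g: "g holomorphic_on ball z r"
  shows "ennreal ((cmod (g z))\<^sup>2) * emeasure lborel (ball z r) \<le> (\<integral>\<^sup>+w\<in>ball z r. ennreal ((cmod (g w))\<^sup>2) \<partial>lborel)"
proof -
  define e where "e t = exp (2 * of_real pi * \<i> * of_real t)" for t :: real
  define G where "G w = indicator (ball z r) w *\<^sub>R g w" for w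
  define F where "F w = ennreal ((cmod (G w))\<^sup>2)" for w
  have [measurable]: "G \<in> borel_measurable borel"
    unfolding G_def using g
    by (intro borel_measurable_continuous_on_indicator) (auto simp: holomorphic_on_imp_continuous_on)
  have F[measurable]: "F \<in> borel_measurable borel" unfolding F_def by measurable
  have [measurable]: "e \<in> borel_measurable borel"
    unfolding e_def by (intro borel_measurable_continuous_onI continuous_intros)
  have e: "cmod (e t) = 1" for t by (simp add: e_def)
  have "ennreal ((cmod (g z))\<^sup>2) * emeasure lborel (ball z r) = (\<integral>\<^sup>+w. ennreal ((cmod (g z))\<^sup>2) * indicator (ball z r) w \<partial>lborel)"
    by (simp add: nn_integral_cmult_indicator)
  also have "\<dots> \<le> (\<integral>\<^sup>+w. \<integral>\<^sup>+t. F (z + e t * (w - z)) * indicator (ball z r) w * indicator {0..1} t \<partial>lborel \<partial>lborel)"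
  proof (intro nn_integral_mono)
    fix w
    show "ennreal ((cmod (g z))\<^sup>2) * indicator (ball z r) w
       \<le> (\<integral>\<^sup>+t. F (z + e t * (w - z)) * indicator (ball z r) w * indicator {0..1} t \<partial>lborel)"
    proof (cases "w \<in> ball z r")
      case True
      have sub: "z + u * (w - z) \<in> ball z r" if "cmod u \<le> 1" for u
        using True mult_right_mono[OF that norm_ge_zero[of "w - z"]]
        by (auto simp: dist_norm norm_mult norm_minus_commute)
      have "(\<lambda>u. g (z + u * (w - z))) holomorphic_on cball 0 1"
        using sub by (intro holomorphic_on_compose_gen[OF _ g, unfolded o_def] holomorphic_intros) auto
      from circle_mean_value_square[OF this]
      have "ennreal ((cmod (g z))\<^sup>2) \<le> (\<integral>\<^sup>+t\<in>{0..1}. ennreal ((cmod (g (z + e t * (w - z))))\<^sup>2) \<partial>lborel)"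
        by (simp add: e_def)
      also have "\<dots> = (\<integral>\<^sup>+t. F (z + e t * (w - z)) * indicator (ball z r) w * indicator {0..1} t \<partial>lborel)"
        using True sub e by (intro nn_integral_cong) (simp add: F_def G_def)
      finally show ?thesis using True by simp
    qed simp
  qed
  also have "\<dots> = (\<integral>\<^sup>+t. \<integral>\<^sup>+w. F (z + e t * (w - z)) * indicator (ball z r) w * indicator {0..1} t \<partial>lborel \<partial>lborel)"
  proof (rule lborel_pair.Fubini')
    have "(\<lambda>x. F (z + e (fst x) * (snd x - z))) \<in> borel_measurable (lborel \<Otimes>\<^sub>M lborel)"
      by measurable
    moreover have "(\<lambda>x. indicator (ball z r) (snd x) :: ennreal) \<in> borel_measurable (lborel \<Otimes>\<^sub>M lborel)"
      by (rule measurable_compose[OF measurable_snd]) (simp add: borel_measurable_indicator)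
    moreover have "(\<lambda>x. indicator {0..1::real} (fst x) :: ennreal) \<in> borel_measurable (lborel \<Otimes>\<^sub>M lborel)"
      by (rule measurable_compose[OF measurable_fst]) (simp add: borel_measurable_indicator)
    ultimately show "(\<lambda>(t, w). F (z + e t * (w - z)) * indicator (ball z r) w * indicator {0..1} t)
        \<in> borel_measurable (lborel \<Otimes>\<^sub>M lborel)"
      unfolding case_prod_beta by (intro borel_measurable_times_ennreal)
  qed
  also have "\<dots> = (\<integral>\<^sup>+t. (\<integral>\<^sup>+w\<in>ball z r. F w \<partial>lborel) * indicator {0..1::real} t \<partial>lborel)"
  proof (intro nn_integral_cong)
    fix t :: real
    show "(\<integral>\<^sup>+w. F (z + e t * (w - z)) * indicator (ball z r) w * indicator {0..1} t \<partial>lborel) =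
        (\<integral>\<^sup>+w\<in>ball z r. F w \<partial>lborel) * indicator {0..1} t"
      using nn_integral_ball_rotate[OF F e[of t], of z r] by (cases "t \<in> {0..1}") simp_all
  qed
  also have "\<dots> = (\<integral>\<^sup>+w\<in>ball z r. F w \<partial>lborel)"
    by (simp add: nn_integral_cmult_indicator)
  also have "\<dots> = (\<integral>\<^sup>+w\<in>ball z r. ennreal ((cmod (g w))\<^sup>2) \<partial>lborel)"
    by (intro nn_integral_cong) (auto simp: F_def G_def indicator_def)
  finally show ?thesis .
qed

section \<open>Weighted Dirichlet integrals\<close>

lemma space_area_measure [simp]: "space area_measure = unit_disk"
  by (simp add: area_measure_def space_scale_measure space_restrict_space)

lemma AE_area_measureI:
  assumes "AE z in lborel. P z"
  shows "AE z in area_measure. P z"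
proof -
  obtain N where N: "{z \<in> space lborel. \<not> P z} \<subseteq> N" "emeasure lborel N = 0" "N \<in> sets lborel"
    using assms by (rule AE_E)
  have "emeasure lborel (N \<inter> unit_disk) \<le> emeasure lborel N"
    using N(3) by (intro emeasure_mono) auto
  then have "emeasure lborel (N \<inter> unit_disk) = 0" using N(2) by simp
  then have "N \<inter> unit_disk \<in> null_sets area_measure"
    using N(3) unfolding area_measure_def null_sets_def
    by (auto simp: sets_restrict_space_iff emeasure_restrict_space)
  then show ?thesis
    by (rule AE_I') (use N(1) in auto)
qed

lemma nn_integral_area_measure:
  fixes f :: "complex \<Rightarrow> ennreal"
  assumes "(\<lambda>z. f z * indicator unit_disk z) \<in> borel_measurable borel"
  shows "(\<integral>\<^sup>+z. f z \<partial>area_measure) = ennreal (1 / pi) * (\<integral>\<^sup>+z\<in>unit_disk. f z \<partial>lborel)"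
  unfolding area_measure_def using assms
  by (subst nn_integral_scale_measure)
     (auto simp: borel_measurable_restrict_space_iff_ennreal nn_integral_restrict_space)

lemma nn_integral_area_measure_cong_disk:
  assumes "\<And>z. cmod z < 1 \<Longrightarrow> f z = g z"
  shows "(\<integral>\<^sup>+z. f z \<partial>area_measure) = (\<integral>\<^sup>+z. g z \<partial>area_measure)"
  using assms by (intro nn_integral_cong) auto

lemma weight_continuous:
  assumes "weight \<omega>"
  shows "continuous_on {0..<1} \<omega>"
proof -
  obtain \<omega>' where "\<And>r. r \<in> {0..<1} \<Longrightarrow> (\<omega> has_real_derivative \<omega>' r) (at r within {0..<1})"
    using assms unfolding weight_def C2_on_unit_def by blast
  then show ?thesis by (rule DERIV_continuous_on)
qed

lemma weight_radial_measurable: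
  assumes "weight \<omega>"
  shows "(\<lambda>z. indicator unit_disk z *\<^sub>R \<omega> (cmod z)) \<in> borel_measurable borel"
  by (intro borel_measurable_continuous_on_indicator continuous_on_compose2[OF weight_continuous[OF assms]])
     (auto intro!: continuous_intros)

lemma deriv_disk_measurable:
  assumes "f holomorphic_on unit_disk"
  shows "(\<lambda>z. indicator unit_disk z *\<^sub>R deriv f z) \<in> borel_measurable borel"
  using assms by (intro borel_measurable_continuous_on_indicator)
    (auto simp: holomorphic_deriv holomorphic_on_imp_continuous_on)

lemma dirichlet_integrand_measurable:
  assumes "weight \<omega>" "f holomorphic_on unit_disk"
  shows "(\<lambda>z. ennreal ((cmod (deriv f z))\<^sup>2 * \<omega> (cmod z)) * indicator unit_disk z) \<in> borel_measurable borel"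
proof -
  note [measurable] = weight_radial_measurable[OF assms(1)] deriv_disk_measurable[OF assms(2)]
  have "(\<lambda>z. ennreal ((cmod (indicator unit_disk z *\<^sub>R deriv f z))\<^sup>2 * (indicator unit_disk z *\<^sub>R \<omega> (cmod z))))
      \<in> borel_measurable borel"
    by measurable
  also have "(\<lambda>z. ennreal ((cmod (indicator unit_disk z *\<^sub>R deriv f z))\<^sup>2 * (indicator unit_disk z *\<^sub>R \<omega> (cmod z))))
     = (\<lambda>z. ennreal ((cmod (deriv f z))\<^sup>2 * \<omega> (cmod z)) * indicator unit_disk z)"
    by (auto simp: indicator_def)
  finally show ?thesis .
qed

lemma dirichlet_integral_eq_lborel:
  assumes "weight \<omega>" "f holomorphic_on unit_disk"
  shows "dirichlet_integral \<omega> f =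
    ennreal (1 / pi) * (\<integral>\<^sup>+z\<in>unit_disk. ennreal ((cmod (deriv f z))\<^sup>2 * \<omega> (cmod z)) \<partial>lborel)"
  unfolding dirichlet_integral_def
  by (rule nn_integral_area_measure[OF dirichlet_integrand_measurable[OF assms]])

text \<open>
  The area formula with weight \<open>\<omega>\<close> and \<open>H = \<bar>f'\<bar>\<^sup>2\<close>. The quotient in \<^const>\<open>tau\<close> cancels
  because the weight is positive and finite on the disk.
\<close>

lemma dirichlet_integral_compose:
  assumes \<omega>: "weight \<omega>" and f: "f holomorphic_on unit_disk"
    and \<phi>: "\<phi> holomorphic_on unit_disk" "\<phi> ` unit_disk \<subseteq> unit_disk"
  shows "dirichlet_integral \<omega> (f \<circ> \<phi>) =
    (\<integral>\<^sup>+z. ennreal ((cmod (deriv f z))\<^sup>2) * tau \<phi> \<omega> z * ennreal (\<omega> (cmod z)) \<partial>area_measure)"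
proof -
  define W where "W z = ennreal (indicator unit_disk z *\<^sub>R \<omega> (cmod z))" for z
  define H where "H z = ennreal ((cmod (indicator unit_disk z *\<^sub>R deriv f z))\<^sup>2)" for z
  note [measurable] = weight_radial_measurable[OF \<omega>] deriv_disk_measurable[OF f]
  have [measurable]: "W \<in> borel_measurable borel" "H \<in> borel_measurable borel"
    unfolding W_def H_def by measurable
  have \<omega>0: "0 < \<omega> (cmod z)" if "cmod z < 1" for z :: complex
    using \<omega> that by (auto simp: weight_def)
  obtain M where M[measurable]: "M \<in> borel_measurable borel"
    and AE_M: "AE w in lborel. (\<Sum>\<^sub>\<infinity>a\<in>{a\<in>unit_disk. \<phi> a = w}. W a) = M w"
    and I: "\<And>H. H \<in> borel_measurable borel \<Longrightarrow>
      (\<integral>\<^sup>+z\<in>unit_disk. H (\<phi> z) * W z * ennreal ((cmod (deriv \<phi> z))\<^sup>2) \<partial>lborel) = (\<integral>\<^sup>+w. H w * M w \<partial>lborel)"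
    by (rule area_formula_holomorphic[of unit_disk \<phi> W]) (use \<phi> in auto)
  have N: "nevanlinna_counting \<phi> \<omega> w = (\<Sum>\<^sub>\<infinity>a\<in>{a\<in>unit_disk. \<phi> a = w}. W a)" for w
    unfolding nevanlinna_counting_def by (intro infsum_cong) (auto simp: W_def)
  have chain: "deriv (f \<circ> \<phi>) z = deriv f (\<phi> z) * deriv \<phi> z" if "z \<in> unit_disk" for z
  proof (rule deriv_chain)
    show "\<phi> field_differentiable at z"
      using \<phi>(1) that by (simp add: holomorphic_on_imp_differentiable_at)
    have "\<phi> z \<in> unit_disk" using \<phi>(2) that by (rule subsetD[OF _ imageI])
    with f show "f field_differentiable at (\<phi> z)"
      by (simp only: holomorphic_on_imp_differentiable_at open_ball)
  qed
  have "dirichlet_integral \<omega> (f \<circ> \<phi>) =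
      ennreal (1 / pi) * (\<integral>\<^sup>+z\<in>unit_disk. ennreal ((cmod (deriv (f \<circ> \<phi>) z))\<^sup>2 * \<omega> (cmod z)) \<partial>lborel)"
    using \<phi> f by (intro dirichlet_integral_eq_lborel \<omega> holomorphic_on_compose_gen)
  also have "(\<integral>\<^sup>+z\<in>unit_disk. ennreal ((cmod (deriv (f \<circ> \<phi>) z))\<^sup>2 * \<omega> (cmod z)) \<partial>lborel) =
      (\<integral>\<^sup>+z\<in>unit_disk. H (\<phi> z) * W z * ennreal ((cmod (deriv \<phi> z))\<^sup>2) \<partial>lborel)"
  proof (intro nn_integral_cong)
    fix z
    show "ennreal ((cmod (deriv (f \<circ> \<phi>) z))\<^sup>2 * \<omega> (cmod z)) * indicator unit_disk z =
      H (\<phi> z) * W z * ennreal ((cmod (deriv \<phi> z))\<^sup>2) * indicator unit_disk z"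
    proof (cases "z \<in> unit_disk")
      case True
      then have "\<phi> z \<in> unit_disk" using \<phi>(2) by (rule subsetD[OF _ imageI, rotated])
      then show ?thesis
        using True \<omega>0[of z] by (simp add: chain H_def W_def ennreal_mult[symmetric] norm_mult power_mult_distrib mult_ac)
    qed simp
  qed
  also have "\<dots> = (\<integral>\<^sup>+w. H w * M w \<partial>lborel)" by (rule I) measurable
  also have "\<dots> = (\<integral>\<^sup>+w\<in>unit_disk. H w * M w \<partial>lborel)"
    by (intro nn_integral_cong) (auto simp: H_def indicator_def)
  also have "ennreal (1 / pi) * \<dots> = (\<integral>\<^sup>+w. H w * M w \<partial>area_measure)"
    by (rule nn_integral_area_measure[symmetric]) (measurable, simp)
  also have "\<dots> = (\<integral>\<^sup>+w. H w * nevanlinna_counting \<phi> \<omega> w \<partial>area_measure)"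
    using AE_area_measureI[OF AE_M] by (intro nn_integral_cong_AE) (auto simp: N)
  also have "\<dots> = (\<integral>\<^sup>+z. ennreal ((cmod (deriv f z))\<^sup>2) * tau \<phi> \<omega> z * ennreal (\<omega> (cmod z)) \<partial>area_measure)"
  proof (rule nn_integral_area_measure_cong_disk)
    fix w :: complex assume w: "cmod w < 1"
    have "tau \<phi> \<omega> w * ennreal (\<omega> (cmod w)) = nevanlinna_counting \<phi> \<omega> w"
      using \<omega>0[OF w] by (simp add: tau_def ennreal_divide_times)
    then show "H w * nevanlinna_counting \<phi> \<omega> w = ennreal ((cmod (deriv f w))\<^sup>2) * tau \<phi> \<omega> w * ennreal (\<omega> (cmod w))"
      using w by (simp add: H_def mult.assoc)
  qed
  finally show ?thesis .
qed

text \<open>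
  For \<open>\<bar>z\<bar> \<le> \<bar>p\<bar>\<close> the ball of radius \<open>r = (1 - \<bar>p\<bar>) / 2\<close> about \<open>z\<close> stays in the disk of radius
  \<open>(1 + \<bar>p\<bar>) / 2\<close>, where the weight is at least its value \<open>m\<close> on the boundary circle. The
  sub-mean value property then bounds \<open>\<bar>f' z\<bar>\<^sup>2\<close> by \<open>D f / (m r\<^sup>2)\<close>, and the mean value
  inequality on the closed disk of radius \<open>\<bar>p\<bar>\<close> bounds \<open>f p - f 0\<close>.
\<close>

lemma point_evaluation_bound:
  assumes \<omega>: "weight \<omega>" "antimono_on {0..<1} \<omega>" and p: "cmod p < 1"
  obtains K where "K \<ge> 0"
    and "\<And>f. f \<in> H_space \<omega> \<Longrightarrow> (cmod (f p - f 0))\<^sup>2 \<le> K * enn2real (dirichlet_integral \<omega> f)"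
proof -
  define r where "r = (1 - cmod p) / 2"
  define m where "m = \<omega> ((1 + cmod p) / 2)"
  have r: "r > 0" using p by (simp add: r_def)
  have m: "m > 0" using p \<omega>(1) unfolding m_def weight_def by (auto simp: field_simps)
  have pi: "emeasure lborel (ball z r) = ennreal (pi * r\<^sup>2)" for z :: complex
    using r by (simp add: emeasure_ball unit_ball_vol_2)
  show thesis
  proof (rule that[of "(cmod p)\<^sup>2 / (m * r\<^sup>2)"])
    fix f assume "f \<in> H_space \<omega>"
    then have f: "f holomorphic_on unit_disk" and fin: "dirichlet_integral \<omega> f < \<infinity>" by (auto simp: H_space_def)
    define d where "d = enn2real (dirichlet_integral \<omega> f)"
    have d0: "d \<ge> 0" by (simp add: d_def)
    have Dd: "dirichlet_integral \<omega> f = ennreal d" using fin by (simp add: d_def)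
    let ?g = "\<lambda>w. ennreal ((cmod (deriv f w))\<^sup>2 * \<omega> (cmod w)) * indicator unit_disk w"
    have Dpi: "(\<integral>\<^sup>+w. ?g w \<partial>lborel) = ennreal (pi * d)"
    proof -
      have "ennreal pi * ennreal d = (ennreal pi * ennreal (1 / pi)) * (\<integral>\<^sup>+w. ?g w \<partial>lborel)"
        unfolding Dd[symmetric] dirichlet_integral_eq_lborel[OF \<omega>(1) f] by (simp add: mult.assoc)
      also have "ennreal pi * ennreal (1 / pi) = 1" by (subst ennreal_mult[symmetric]) auto
      finally show ?thesis using d0 by (simp add: ennreal_mult)
    qed
    have bound: "cmod (deriv f z) \<le> sqrt (d / (m * r\<^sup>2))" if z: "cmod z \<le> cmod p" for z
    proof -
      have sub: "cmod w \<le> (1 + cmod p) / 2" if "w \<in> ball z r" for w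
        using that z norm_triangle_ineq2[of w z] by (auto simp: r_def dist_norm norm_minus_commute)
      have sub': "ball z r \<subseteq> unit_disk" using sub p by fastforce
      have "ennreal ((cmod (deriv f z))\<^sup>2 * (pi * r\<^sup>2)) = ennreal ((cmod (deriv f z))\<^sup>2) * emeasure lborel (ball z r)"
        by (simp add: pi ennreal_mult)
      also have "\<dots> \<le> (\<integral>\<^sup>+w\<in>ball z r. ennreal ((cmod (deriv f w))\<^sup>2) \<partial>lborel)"
        using f sub' by (intro holomorphic_sub_mean_value_ball holomorphic_on_subset[OF holomorphic_deriv]) auto
      also have "\<dots> \<le> (\<integral>\<^sup>+w. ennreal (1 / m) * ?g w \<partial>lborel)"
      proof (intro nn_integral_mono)
        fix w
        show "ennreal ((cmod (deriv f w))\<^sup>2) * indicator (ball z r) w \<le> ennreal (1 / m) * ?g w"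
        proof (cases "w \<in> ball z r")
          case True
          have w1: "w \<in> unit_disk" using True sub' by blast
          then have "m \<le> \<omega> (cmod w)"
            unfolding m_def using sub[OF True] p by (intro monotone_onD[OF \<omega>(2)]) auto
          then have "(cmod (deriv f w))\<^sup>2 * 1 \<le> (cmod (deriv f w))\<^sup>2 * (\<omega> (cmod w) / m)"
            using m by (intro mult_left_mono) auto
          then have "ennreal ((cmod (deriv f w))\<^sup>2) \<le> ennreal (1 / m * ((cmod (deriv f w))\<^sup>2 * \<omega> (cmod w)))"
            by (intro ennreal_leI) (simp add: field_simps)
          also have "\<dots> = ennreal (1 / m) * ennreal ((cmod (deriv f w))\<^sup>2 * \<omega> (cmod w))"
            using m by (intro ennreal_mult') auto
          finally show ?thesis using True w1 by simp
        qed simp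
      qed
      also have "\<dots> = ennreal (1 / m) * ennreal (pi * d)"
        using dirichlet_integrand_measurable[OF \<omega>(1) f] by (simp add: nn_integral_cmult Dpi)
      also have "\<dots> = ennreal (pi * d / m)" using m d0 by (simp add: ennreal_mult[symmetric])
      finally have "(cmod (deriv f z))\<^sup>2 * (pi * r\<^sup>2) \<le> pi * d / m"
        using m d0 by (subst (asm) ennreal_le_iff) auto
      then have "(cmod (deriv f z))\<^sup>2 \<le> d / (m * r\<^sup>2)"
        using m r by (simp add: field_simps)
      then show ?thesis by (rule real_le_rsqrt)
    qed
    have "cmod (f p - f 0) \<le> sqrt (d / (m * r\<^sup>2)) * cmod (p - 0)"
    proof (rule field_differentiable_bound[of "cball 0 (cmod p)"])
      fix z :: complex assume "z \<in> cball 0 (cmod p)"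
      then have z: "cmod z \<le> cmod p" by simp
      show "(f has_field_derivative deriv f z) (at z within cball 0 (cmod p))"
        using z p by (intro has_field_derivative_at_within[OF holomorphic_derivI[OF f]]) auto
      show "cmod (deriv f z) \<le> sqrt (d / (m * r\<^sup>2))" by (rule bound[OF z])
    qed auto
    then have "(cmod (f p - f 0))\<^sup>2 \<le> (sqrt (d / (m * r\<^sup>2)) * cmod p)\<^sup>2"
      by (intro power_mono) auto
    also have "\<dots> = (cmod p)\<^sup>2 / (m * r\<^sup>2) * d"
      using d0 m r by (simp add: power_mult_distrib)
    finally show "(cmod (f p - f 0))\<^sup>2 \<le> (cmod p)\<^sup>2 / (m * r\<^sup>2) * enn2real (dirichlet_integral \<omega> f)"
      by (simp add: d_def)
  qed (use m in auto)
qed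

section \<open>Closed range\<close>

lemma H_norm_square: "(H_norm \<omega> f)\<^sup>2 = (cmod (f 0))\<^sup>2 + enn2real (dirichlet_integral \<omega> f)"
  by (simp add: H_norm_def)

lemma dirichlet_integral_diff_const:
  assumes "f holomorphic_on unit_disk"
  shows "dirichlet_integral \<omega> (\<lambda>z. f z - a) = dirichlet_integral \<omega> f"
  unfolding dirichlet_integral_def
proof (rule nn_integral_area_measure_cong_disk)
  fix z :: complex assume "cmod z < 1"
  then have "deriv (\<lambda>z. f z - a) z = deriv f z"
    using assms by (subst deriv_diff) (auto simp: holomorphic_on_imp_differentiable_at)
  then show "ennreal ((cmod (deriv (\<lambda>z. f z - a) z))\<^sup>2 * \<omega> (cmod z)) = ennreal ((cmod (deriv f z))\<^sup>2 * \<omega> (cmod z))"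
    by simp
qed

text \<open>
  Boundedness of the operator guarantees that \<open>D (f \<circ> \<phi>)\<close> is finite, so that the real-valued norm
  really records it.
\<close>

lemma closed_range_iff_dirichlet_lower_bound:
  assumes \<omega>: "weight \<omega>" "antimono_on {0..<1} \<omega>"
    and \<phi>: "\<phi> holomorphic_on unit_disk" "\<phi> ` unit_disk \<subseteq> unit_disk"
    and bounded: "H_bounded \<omega> (composition_operator \<phi>)"
  shows "H_closed_range \<omega> (composition_operator \<phi>) \<longleftrightarrow>
    (\<exists>c>0. \<forall>f\<in>H_space \<omega>. ennreal c * dirichlet_integral \<omega> f \<le> dirichlet_integral \<omega> (f \<circ> \<phi>))"
    (is "_ \<longleftrightarrow> ?R")
proof
  note self_map = bspec[OF conjunct1[OF bounded[unfolded H_bounded_def composition_operator_def]]]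
  assume "H_closed_range \<omega> (composition_operator \<phi>)"
  then obtain c where c: "c > 0" and le: "\<And>f. f \<in> H_space \<omega> \<Longrightarrow> c * H_norm \<omega> f \<le> H_norm \<omega> (f \<circ> \<phi>)"
    by (auto simp: H_closed_range_def composition_operator_def)
  have "ennreal (c\<^sup>2) * dirichlet_integral \<omega> f \<le> dirichlet_integral \<omega> (f \<circ> \<phi>)" if f: "f \<in> H_space \<omega>" for f
  proof -
    define g where "g z = f z - f (\<phi> 0)" for z
    have hf: "f holomorphic_on unit_disk" using f by (simp add: H_space_def)
    have Dg: "dirichlet_integral \<omega> g = dirichlet_integral \<omega> f"
      unfolding g_def by (rule dirichlet_integral_diff_const[OF hf])
    have g: "g \<in> H_space \<omega>"
      using f Dg by (auto simp: H_space_def g_def[abs_def] intro!: holomorphic_intros)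
    have "f \<circ> \<phi> \<in> H_space \<omega>" by (rule self_map[OF f])
    then have hfp: "f \<circ> \<phi> holomorphic_on unit_disk" and fin: "dirichlet_integral \<omega> (f \<circ> \<phi>) < \<infinity>"
      by (auto simp: H_space_def)
    have "g \<circ> \<phi> = (\<lambda>z. (f \<circ> \<phi>) z - f (\<phi> 0))" by (auto simp: g_def)
    then have Dgp: "dirichlet_integral \<omega> (g \<circ> \<phi>) = dirichlet_integral \<omega> (f \<circ> \<phi>)"
      using dirichlet_integral_diff_const[OF hfp] by simp
    have "c\<^sup>2 * enn2real (dirichlet_integral \<omega> f) \<le> c\<^sup>2 * (H_norm \<omega> g)\<^sup>2"
      unfolding H_norm_square Dg by (intro mult_left_mono) auto
    also have "\<dots> = (c * H_norm \<omega> g)\<^sup>2" by (simp add: power_mult_distrib)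
    also have "\<dots> \<le> (H_norm \<omega> (g \<circ> \<phi>))\<^sup>2"
      using le[OF g] c by (intro power_mono) (auto simp: H_norm_def)
    also have "\<dots> = enn2real (dirichlet_integral \<omega> (f \<circ> \<phi>))"
      unfolding H_norm_square Dgp by (simp add: g_def)
    finally have "ennreal (c\<^sup>2 * enn2real (dirichlet_integral \<omega> f)) \<le> ennreal (enn2real (dirichlet_integral \<omega> (f \<circ> \<phi>)))"
      by (rule ennreal_leI)
    then show ?thesis using f fin by (simp add: ennreal_mult H_space_def)
  qed
  then show ?R using c by (intro exI[of _ "c\<^sup>2"]) auto
next
  note self_map = bspec[OF conjunct1[OF bounded[unfolded H_bounded_def composition_operator_def]]]
  assume ?R
  then obtain c where c: "c > 0" and le: "\<And>f. f \<in> H_space \<omega> \<Longrightarrow> ennreal c * dirichlet_integral \<omega> f \<le> dirichlet_integral \<omega> (f \<circ> \<phi>)"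
    by auto
  have "\<phi> 0 \<in> unit_disk" using \<phi>(2) by (rule subsetD) simp
  then have "cmod (\<phi> 0) < 1" by simp
  from point_evaluation_bound[OF \<omega> this]
  obtain K where K: "K \<ge> 0"
    and ev: "\<And>f. f \<in> H_space \<omega> \<Longrightarrow> (cmod (f (\<phi> 0) - f 0))\<^sup>2 \<le> K * enn2real (dirichlet_integral \<omega> f)"
    by blast
  \<comment> \<open>Chosen so that \<open>C\<close> dominates the factor 2 of \<open>\<bar>f (\<phi> 0)\<bar>\<^sup>2\<close> and \<open>C c\<close> the factor of \<open>D f\<close>.\<close>
  define C where "C = 2 + (2 * K + 1) / c"
  have C: "C > 0" "2 \<le> C" "2 * K + 1 \<le> C * c" using K c by (auto simp: C_def field_simps add_pos_nonneg)
  have "1 / sqrt C * H_norm \<omega> f \<le> H_norm \<omega> (f \<circ> \<phi>)" if f: "f \<in> H_space \<omega>" for f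
  proof -
    define d where "d = enn2real (dirichlet_integral \<omega> f)"
    define d' where "d' = enn2real (dirichlet_integral \<omega> (f \<circ> \<phi>))"
    have d0: "d \<ge> 0" "d' \<ge> 0" by (auto simp: d_def d'_def)
    have fin: "dirichlet_integral \<omega> f < \<infinity>" "dirichlet_integral \<omega> (f \<circ> \<phi>) < \<infinity>"
      using f self_map[OF f] by (auto simp: H_space_def)
    have "ennreal (c * d) \<le> ennreal d'"
      using le[OF f] fin c by (simp add: ennreal_mult' d_def d'_def)
    then have dd: "c * d \<le> d'" using d0 by (simp add: ennreal_le_iff)
    have "cmod (f 0) \<le> cmod (f (\<phi> 0)) + cmod (f (\<phi> 0) - f 0)"
      using norm_triangle_ineq4[of "f (\<phi> 0)" "f (\<phi> 0) - f 0"] by simp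
    then have "(cmod (f 0))\<^sup>2 \<le> (cmod (f (\<phi> 0)) + cmod (f (\<phi> 0) - f 0))\<^sup>2" by (intro power_mono) auto
    also have "\<dots> \<le> 2 * (cmod (f (\<phi> 0)))\<^sup>2 + 2 * (cmod (f (\<phi> 0) - f 0))\<^sup>2"
      using sum_squares_bound[of "cmod (f (\<phi> 0))" "cmod (f (\<phi> 0) - f 0)"] by (simp add: power2_sum)
    also have "\<dots> \<le> 2 * (cmod (f (\<phi> 0)))\<^sup>2 + 2 * (K * d)"
      using ev[OF f] by (simp add: d_def)
    finally have "(cmod (f 0))\<^sup>2 + d \<le> 2 * (cmod (f (\<phi> 0)))\<^sup>2 + (2 * K + 1) * d"
      by (simp add: algebra_simps)
    also have "\<dots> \<le> C * (cmod (f (\<phi> 0)))\<^sup>2 + (C * c) * d"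
      using C d0 by (intro add_mono mult_right_mono) auto
    also have "\<dots> \<le> C * ((cmod (f (\<phi> 0)))\<^sup>2 + d')"
      using mult_left_mono[OF dd, of C] C by (simp add: algebra_simps)
    finally have "(H_norm \<omega> f)\<^sup>2 \<le> C * (H_norm \<omega> (f \<circ> \<phi>))\<^sup>2"
      by (simp add: H_norm_square d_def d'_def)
    then have "sqrt ((H_norm \<omega> f)\<^sup>2) \<le> sqrt (C * (H_norm \<omega> (f \<circ> \<phi>))\<^sup>2)" by (rule real_sqrt_le_mono)
    then have "H_norm \<omega> f \<le> sqrt C * H_norm \<omega> (f \<circ> \<phi>)"
      by (simp add: real_sqrt_mult H_norm_def)
    then show ?thesis using C by (simp add: field_simps)
  qed
  then show "H_closed_range \<omega> (composition_operator \<phi>)"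
    unfolding H_closed_range_def composition_operator_def using C(1)
    by (intro exI[of _ "1 / sqrt C"]) auto
qed

theorem proposition5p1:
  fixes \<omega> :: "real \<Rightarrow> real" and \<phi> :: "complex \<Rightarrow> complex"
  assumes "admissible_weight \<omega>"
    and "\<phi> holomorphic_on unit_disk"
    and "\<phi> ` unit_disk \<subseteq> unit_disk"
    and "H_bounded \<omega> (composition_operator \<phi>)"
  shows "H_closed_range \<omega> (composition_operator \<phi>) \<longleftrightarrow>
    (\<exists>c::real. c > 0 \<and> (\<forall>f\<in>H_space \<omega>.
       (\<integral>\<^sup>+z. ennreal ((cmod (deriv f z))\<^sup>2) * tau \<phi> \<omega> z * ennreal (\<omega> (cmod z)) \<partial>area_measure)
       \<ge> ennreal c * (\<integral>\<^sup>+z. ennreal ((cmod (deriv f z))\<^sup>2 * \<omega> (cmod z)) \<partial>area_measure)))"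
proof -
  have \<omega>: "weight \<omega>" "antimono_on {0..<1} \<omega>"
    using assms(1) by (auto simp: admissible_weight_def)
  note iff = closed_range_iff_dirichlet_lower_bound[OF \<omega> assms(2-4)]
  have "dirichlet_integral \<omega> (f \<circ> \<phi>) =
      (\<integral>\<^sup>+z. ennreal ((cmod (deriv f z))\<^sup>2) * tau \<phi> \<omega> z * ennreal (\<omega> (cmod z)) \<partial>area_measure)"
    if "f \<in> H_space \<omega>" for f
    using that by (intro dirichlet_integral_compose \<omega> assms(2,3)) (auto simp: H_space_def)
  then show ?thesis
    unfolding iff by (simp flip: dirichlet_integral_def cong: ball_cong)
qed

end
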